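(* Let $m,n\ge 1$ be integers, let $i$ be an integer with $1\le i\le\min(2^m,2^n)$, and let $L=(\delta_{2^m}^{i})^{T}$. Let $(x_k^\star)_{k\ge 0}$ and $(u_k^\star)_{k\ge 0}$ be sequences with $u_k^\star\in\Delta_{2^m}$ for all $k\ge0$, $x_0^\star=\delta_{2^n}^{i}$, satisfying for every $k\ge 0$ the state update law $$x_{k+1}^\star=L\ltimes u_k^\star\ltimes x_k^\star$$ and the optimality equation $$u_k^\star=L^{T}\ltimes (x_k^\star)^{T}\ltimes L\ltimes u_k^\star\ltimes x_k^\star .$$ Then $u_k^\star=\delta_{2^m}^{i}$ and $x_k^\star=\delta_{2^n}^{i}$ for every $k\ge 0$; that is, the optimal control and the optimal trajectory are constant in time (the system is in a cycle of length $1$, a fixed point).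
   Context: $\delta_N^{i}$ denotes the $i$-th column of the identity matrix $I_N$, and $\Delta_N=\{\delta_N^1,\dots,\delta_N^N\}$ is the set of columns of $I_N$. For real matrices $A$ of size $p\times q$ and $B$ of size $r\times s$, with $t=\mathrm{lcm}(q,r)$, the semi-tensor product is $A\ltimes B:=(A\otimes I_{t/q})(B\otimes I_{t/r})$, where $\otimes$ is the Kronecker product; $\ltimes$ is associative. Boolean values are identified with vectors via $1=\delta_2^1$, $0=\delta_2^2$. A Boolean network with $n$ state nodes and $m$ control nodes has joint state $x_k=x_k^1\ltimes\cdots\ltimes x_k^n$ and joint control $u_k=u_k^1\ltimes\cdots\ltimes u_k^m\in\Delta_{2^m}$, each $x_k^j,u_k^j\in\Delta_2$. *)

theory Defs
  imports Complex_Main "Jordan_Normal_Form.Matrix"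
begin

(* Columns of the identity are kept as N x 1 matrices, so that they can be factors of the
   semi-tensor product. The superscript i is 1-based, library matrix indices are 0-based;
   delta N i is meaningful only for 1 <= i <= N. *)
definition delta :: "nat \<Rightarrow> nat \<Rightarrow> real mat" where
  "delta N i = mat_of_cols N [col (1\<^sub>m N) (i - 1)]"

definition Delta :: "nat \<Rightarrow> real mat set" where
  "Delta N = delta N ` {1..N}"

definition kron :: "real mat \<Rightarrow> real mat \<Rightarrow> real mat" where
  "kron A B = mat (dim_row A * dim_row B) (dim_col A * dim_col B)
     (\<lambda>(i, j). A $$ (i div dim_row B, j div dim_col B) * B $$ (i mod dim_row B, j mod dim_col B))"

definition stp :: "real mat \<Rightarrow> real mat \<Rightarrow> real mat" (infixl \<open>\<ltimes>\<close> 70) where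
  "A \<ltimes> B = (let t = lcm (dim_col A) (dim_row B)
     in kron A (1\<^sub>m (t div dim_col A)) * kron B (1\<^sub>m (t div dim_row B)))"

end

(* Read from the left, the product L^T x^T L u x is L^T times a row vector, so it is supported
   in row i. A column of the identity supported in row i is delta^i, which settles u; then
   L u is the 1 x 1 identity and the state does not move. *)
theory Submission
  imports Defs
begin

lemma dim_delta [simp]: "dim_row (delta N i) = N" "dim_col (delta N i) = 1"
  by (auto simp: delta_def)

lemma index_delta:
  assumes "1 \<le> i" "i \<le> N" "r < N"
  shows "delta N i $$ (r, 0) = (if r = i - 1 then 1 else 0)"
  using assms by (auto simp: delta_def mat_of_cols_index)

lemma dim_kron [simp]:
  "dim_row (kron A B) = dim_row A * dim_row B"
  "dim_col (kron A B) = dim_col A * dim_col B"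
  by (auto simp: kron_def)

lemma kron_one_right [simp]: "kron A (1\<^sub>m (Suc 0)) = A"
  by (rule eq_matI) (auto simp: kron_def)

lemma kron_one_left [simp]: "kron (1\<^sub>m (Suc 0)) A = A"
  by (rule eq_matI) (auto simp: kron_def)

text \<open>Here the lcm is \<open>dim_col A\<close>, so \<open>A\<close> is only tensored with the
  1 x 1 identity and stays intact as the left factor of an ordinary product. Positivity excludes
  \<open>0 div 0\<close>.\<close>

lemma stp_dvd:
  assumes "dim_row B dvd dim_col A" "dim_col A > 0"
  shows "A \<ltimes> B = A * kron B (1\<^sub>m (dim_col A div dim_row B))"
  using assms by (simp add: stp_def lcm_proj1_if_dvd)

text \<open>The scalar identity is inflated to the identity of size
  \<open>dim_row A\<close>.\<close>

lemma stp_one_left: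
  assumes "dim_row A > 0"
  shows "1\<^sub>m (Suc 0) \<ltimes> A = A"
  using assms by (simp add: stp_def)

text \<open>The index is 0-based, so the support of \<open>delta N i\<close> is row
  \<open>i - 1\<close>.\<close>

definition row_supported :: "nat \<Rightarrow> 'a::zero mat \<Rightarrow> bool" where
  "row_supported i A \<longleftrightarrow> (\<forall>r < dim_row A. \<forall>c < dim_col A. r \<noteq> i \<longrightarrow> A $$ (r, c) = 0)"

text \<open>Row \<open>r\<close> of \<open>A * B\<close> is row \<open>r\<close> of \<open>A\<close>
  times \<open>B\<close>, so zero rows of the left factor survive.\<close>

lemma row_supported_mult:
  fixes A B :: "'a::semiring_0 mat"
  assumes "row_supported i A" "dim_col A = dim_row B"
  shows "row_supported i (A * B)"
  using assms by (auto simp: row_supported_def scalar_prod_def intro!: sum.neutral)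

lemma row_supported_stp:
  assumes "row_supported i A" "dim_row B dvd dim_col A" "dim_col A > 0"
  shows "row_supported i (A \<ltimes> B)"
  using assms by (simp add: stp_dvd row_supported_mult)

lemma dim_stp_dvd:
  assumes "dim_row B dvd dim_col A" "dim_col A > 0"
  shows "dim_col (A \<ltimes> B) = dim_col B * (dim_col A div dim_row B)"
  using assms by (simp add: stp_dvd)

lemma row_supported_delta:
  assumes "1 \<le> i" "i \<le> N"
  shows "row_supported (i - 1) (delta N i)"
  using assms by (auto simp: row_supported_def index_delta)

text \<open>The entry 1 of a column of the identity must lie in the only row allowed to be nonzero.
  Both superscripts are at least 1, so truncated subtraction loses nothing.\<close>

lemma delta_eq_of_row_supported:
  assumes "v \<in> Delta N" "row_supported (i - 1) v" "1 \<le> i"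
  shows "v = delta N i"
proof -
  obtain j where j: "1 \<le> j" "j \<le> N" "v = delta N j"
    using assms(1) by (auto simp: Delta_def)
  have "v $$ (j - 1, 0) = 1"
    using j by (simp add: index_delta)
  moreover have "j - 1 < dim_row v" "0 < dim_col v"
    using j by simp_all
  ultimately have "j - 1 = i - 1"
    using assms(2) unfolding row_supported_def by (metis zero_neq_one)
  then have "j = i"
    using j(1) assms(3) by linarith
  then show ?thesis
    using j(3) by simp
qed

lemma delta_inner_self:
  assumes "1 \<le> i" "i \<le> N"
  shows "(delta N i)\<^sup>T \<ltimes> delta N i = 1\<^sub>m (Suc 0)"
proof -
  have "(delta N i)\<^sup>T * delta N i = 1\<^sub>m (Suc 0)"
    using assms
    by (intro eq_matI) (auto simp: scalar_prod_def index_delta if_distrib cong: if_cong)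
  then show ?thesis
    using assms by (simp add: stp_dvd)
qed

text \<open>Multiplying from the left, the partial products have 1, \<open>N\<close>,
  \<open>M * N\<close>, \<open>N\<close>, 1 columns. The next factors have 1, 1, \<open>M\<close>,
  \<open>N\<close> rows, so divisibility holds at each stage.\<close>

lemma feedback_row_supported:
  assumes "1 \<le> i" "i \<le> M" "N > 0"
    and "dim_row v = M" "dim_col v = 1" "dim_row y = N" "dim_col y = 1"
  shows "row_supported (i - 1)
    (delta M i \<ltimes> y\<^sup>T \<ltimes> (delta M i)\<^sup>T \<ltimes> v \<ltimes> y)"
proof -
  have "M > 0" using assms by simp
  with assms show ?thesis
    by (intro row_supported_stp row_supported_delta) (simp_all add: dim_stp_dvd)
qed

theorem mainTheorem3:
  fixes m n i :: nat
    and L :: "real mat"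
    and x u :: "nat \<Rightarrow> real mat"
  assumes "m \<ge> 1" and "n \<ge> 1"
    and "1 \<le> i" and "i \<le> min (2 ^ m) (2 ^ n)"
    and "L = (delta (2 ^ m) i)\<^sup>T"
    and "\<And>k. u k \<in> Delta (2 ^ m)"
    and "x 0 = delta (2 ^ n) i"
    and "\<And>k. x (Suc k) = L \<ltimes> u k \<ltimes> x k"
    and "\<And>k. u k = L\<^sup>T \<ltimes> (x k)\<^sup>T \<ltimes> L \<ltimes> u k \<ltimes> x k"
  shows "\<forall>k. u k = delta (2 ^ m) i \<and> x k = delta (2 ^ n) i"
proof -
  have u_eq: "u k = delta (2 ^ m) i" if xk: "x k = delta (2 ^ n) i" for k
  proof (rule delta_eq_of_row_supported)
    show "u k \<in> Delta (2 ^ m)" by fact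
    have "dim_row (u k) = 2 ^ m" "dim_col (u k) = 1"
      using assms(6)[of k] by (auto simp: Delta_def)
    \<comment> \<open>Although \<open>u k\<close> occurs on both sides of the optimality equation,
      only its shape matters on the right, so there is no circularity.\<close>
    then have "row_supported (i - 1) (L\<^sup>T \<ltimes> (x k)\<^sup>T \<ltimes> L \<ltimes> u k \<ltimes> x k)"
      unfolding assms(5) transpose_transpose
      by (intro feedback_row_supported[where N = "2 ^ n"]) (use assms(3,4) xk in auto)
    then show "row_supported (i - 1) (u k)"
      using assms(9)[of k] by simp
  qed fact
  have "x k = delta (2 ^ n) i" for k
  proof (induction k)
    case 0
    show ?case by fact
  next
    case (Suc k)
    \<comment> \<open>The induction hypothesis on the state fixes the control at the same time
      \<open>k\<close>.\<close>
    have "L \<ltimes> u k = 1\<^sub>m (Suc 0)"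
      using u_eq[OF Suc] assms(3,4,5) by (simp add: delta_inner_self)
    then show ?case
      using Suc by (simp add: assms(8) stp_one_left)
  qed
  with u_eq show ?thesis by blast
qed

end
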